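(* Let $\mathbb K$ be $\mathbb H$ or $\mathbb O$ and let $f:\mathbb K\to\mathbb K\times\operatorname{Im}(\mathbb K)$ be defined by $$f(x+Iy)=(\sinh x\cos y+I\sinh x\sin y,\ Iy)$$ for $I\in\mathbb S$, $x,y\in\mathbb R$. Then $f(\mathbb K)$ is a parameterized hypercomplex Riemann manifold (diffeomorphic to $\mathbb K$) and $f$ is a slice isothermal parameterization.
   Context: $\mathbb K$ is the division algebra of quaternions $\mathbb H$ or octonions $\mathbb O$, identified with $\mathbb R^{\dim\mathbb K}$ ($\dim\mathbb K=4$ or $8$) with the Euclidean scalar product; $\operatorname{Im}(\mathbb K)$ is the space of purely imaginary elements. $\mathbb S=\{I\in\mathbb K: I^2=-1\}$; every $q\in\mathbb K$ can be written $q=x+Iy$ with $x,y\in\mathbb R$, $I\in\mathbb S$. For $I\in\mathbb S$, $\mathbb C_I=\mathbb R+I\mathbb R$ and $\mathbb C_I^\perp$ is its orthogonal complement in $\mathbb K$. A linear map $T$ from an $n$-dimensional Euclidean space to $\mathbb R^N$ is conformal if $T^tT=k\,\mathrm{Id}$ with $k\ne0$. A slice domain $\Omega\subseteq\mathbb K$ is an open connected set containing real points such that $\Omega\cap\mathbb C_I$ is a domain of $\mathbb C_I$ for each $I\in\mathbb S$. A $C^1$ map $f:\Omega\to\mathbb R^N$ ($N\ge\dim\mathbb K$) is slice conformal (slice isothermal) if for all $I\in\mathbb S$ and all $x+Iy\in\Omega$ both $df(x+Iy)_{|\mathbb C_I}$ and $df(x+Iy)_{|\mathbb C_I^\perp}$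 are conformal. If $f$ is in addition an injective immersion, $f$ is a slice conformal (slice isothermal) parameterization and $f(\Omega)$ is a parameterized hypercomplex Riemann manifold of $\mathbb R^N$. *)

theory Defs
  imports "HOL-Analysis.Analysis"
begin

section \<open>Quaternions and octonions\<close>

text \<open>
  The class only collects the operations used below: the octonions are not associative, so the
  ring classes and \<open>of_real\<close> are not available, and a real number \<open>x\<close> is embedded as \<open>x *\<^sub>R 1\<close>.
\<close>

class hypercomplex = euclidean_space + one + times +
  fixes hRe :: "'a \<Rightarrow> real"

datatype quat = Quat (qa: real) (qb: real) (qc: real) (qd: real)

lemma quat_eq_iff: "p = q \<longleftrightarrow> qa p = qa q \<and> qb p = qb q \<and> qc p = qc q \<and> qd p = qd q"
  by (cases p; cases q) auto

instantiation quat :: real_inner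
begin

definition "0 = Quat 0 0 0 0"
definition "p + q = Quat (qa p + qa q) (qb p + qb q) (qc p + qc q) (qd p + qd q)"
definition "- p = Quat (- qa p) (- qb p) (- qc p) (- qd p)"
definition "p - q = Quat (qa p - qa q) (qb p - qb q) (qc p - qc q) (qd p - qd q)"
definition "r *\<^sub>R p = Quat (r * qa p) (r * qb p) (r * qc p) (r * qd p)"
definition "p \<bullet> q = qa p * qa q + qb p * qb q + qc p * qc q + qd p * qd q"
definition "norm (p :: quat) = sqrt (p \<bullet> p)"
definition "sgn (p :: quat) = inverse (norm p) *\<^sub>R p"
definition "dist p (q :: quat) = norm (p - q)"
definition uniformity_quat_def:
  "(uniformity :: (quat \<times> quat) filter) = (INF e\<in>{0 <..}. principal {(p, q). dist p q < e})"
definition open_quat_def: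
  "open (U :: quat set) \<longleftrightarrow> (\<forall>p\<in>U. eventually (\<lambda>(p', q). p' = p \<longrightarrow> q \<in> U) uniformity)"

instance
proof
  fix p q :: quat
  show "0 \<le> p \<bullet> p"
    by (simp add: inner_quat_def)
  show "p \<bullet> p = 0 \<longleftrightarrow> p = 0"
    unfolding inner_quat_def quat_eq_iff zero_quat_def quat.sel
    by (simp add: add_nonneg_eq_0_iff)
qed (simp_all add: zero_quat_def plus_quat_def uminus_quat_def minus_quat_def scaleR_quat_def
       inner_quat_def norm_quat_def sgn_quat_def dist_quat_def uniformity_quat_def open_quat_def
       algebra_simps)

end

lemma quat_sel_simps [simp]:
  "qa 0 = 0" "qb 0 = 0" "qc 0 = 0" "qd 0 = 0"
  "qa (p + q) = qa p + qa q" "qb (p + q) = qb p + qb q"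
  "qc (p + q) = qc p + qc q" "qd (p + q) = qd p + qd q"
  "qa (- p) = - qa p" "qb (- p) = - qb p" "qc (- p) = - qc p" "qd (- p) = - qd p"
  "qa (p - q) = qa p - qa q" "qb (p - q) = qb p - qb q"
  "qc (p - q) = qc p - qc q" "qd (p - q) = qd p - qd q"
  "qa (r *\<^sub>R p) = r * qa p" "qb (r *\<^sub>R p) = r * qb p"
  "qc (r *\<^sub>R p) = r * qc p" "qd (r *\<^sub>R p) = r * qd p"
  by (simp_all add: zero_quat_def plus_quat_def uminus_quat_def minus_quat_def scaleR_quat_def)

instantiation quat :: euclidean_space
begin

definition "Basis = {Quat 1 0 0 0, Quat 0 1 0 0, Quat 0 0 1 0, Quat 0 0 0 1}"

instance
proof
  fix x :: quat
  show "(\<forall>u\<in>Basis. x \<bullet> u = 0) \<longleftrightarrow> x = 0"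
    by (simp add: Basis_quat_def inner_quat_def quat_eq_iff [of x 0])
qed (auto simp: Basis_quat_def inner_quat_def)

end

lemma DIM_quat: "DIM(quat) = 4"
  by (simp add: Basis_quat_def)

instantiation quat :: hypercomplex
begin

definition "1 = Quat 1 0 0 0"
definition "p * q = Quat
  (qa p * qa q - qb p * qb q - qc p * qc q - qd p * qd q)
  (qa p * qb q + qb p * qa q + qc p * qd q - qd p * qc q)
  (qa p * qc q - qb p * qd q + qc p * qa q + qd p * qb q)
  (qa p * qd q + qb p * qc q - qc p * qb q + qd p * qa q)"
definition "hRe = qa"

instance ..

end

definition qcnj :: "quat \<Rightarrow> quat" where
  "qcnj p = Quat (qa p) (- qb p) (- qc p) (- qd p)"

lemma quat_norm_mult: "norm (p * q) = norm p * norm (q :: quat)"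
  unfolding norm_quat_def real_sqrt_mult [symmetric] inner_quat_def times_quat_def quat.sel
  by (rule arg_cong [where f = sqrt]) (simp add: algebra_simps)

datatype octo = Octo (oa: quat) (ob: quat)

lemma octo_eq_iff: "p = q \<longleftrightarrow> oa p = oa q \<and> ob p = ob q"
  by (cases p; cases q) auto

instantiation octo :: real_inner
begin

definition "0 = Octo 0 0"
definition "p + q = Octo (oa p + oa q) (ob p + ob q)"
definition "- p = Octo (- oa p) (- ob p)"
definition "p - q = Octo (oa p - oa q) (ob p - ob q)"
definition "r *\<^sub>R p = Octo (r *\<^sub>R oa p) (r *\<^sub>R ob p)"
definition "p \<bullet> q = oa p \<bullet> oa q + ob p \<bullet> ob q"
definition "norm (p :: octo) = sqrt (p \<bullet> p)"
definition "sgn (p :: octo) = inverse (norm p) *\<^sub>R p"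
definition "dist p (q :: octo) = norm (p - q)"
definition uniformity_octo_def:
  "(uniformity :: (octo \<times> octo) filter) = (INF e\<in>{0 <..}. principal {(p, q). dist p q < e})"
definition open_octo_def:
  "open (U :: octo set) \<longleftrightarrow> (\<forall>p\<in>U. eventually (\<lambda>(p', q). p' = p \<longrightarrow> q \<in> U) uniformity)"

instance
proof
  fix p q :: octo
  show "p \<bullet> p = 0 \<longleftrightarrow> p = 0"
    unfolding inner_octo_def octo_eq_iff zero_octo_def
    by (simp add: add_nonneg_eq_0_iff)
qed (simp_all add: zero_octo_def plus_octo_def uminus_octo_def minus_octo_def scaleR_octo_def
       inner_octo_def norm_octo_def sgn_octo_def dist_octo_def uniformity_octo_def open_octo_def
       algebra_simps inner_commute)

end

lemma octo_sel_simps [simp]: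
  "oa 0 = 0" "ob 0 = 0"
  "oa (p + q) = oa p + oa q" "ob (p + q) = ob p + ob q"
  "oa (- p) = - oa p" "ob (- p) = - ob p"
  "oa (p - q) = oa p - oa q" "ob (p - q) = ob p - ob q"
  "oa (r *\<^sub>R p) = r *\<^sub>R oa p" "ob (r *\<^sub>R p) = r *\<^sub>R ob p"
  by (simp_all add: zero_octo_def plus_octo_def uminus_octo_def minus_octo_def scaleR_octo_def)

instantiation octo :: euclidean_space
begin

definition "Basis = (\<lambda>b. Octo b 0) ` Basis \<union> Octo 0 ` Basis"

instance
proof
  fix u v :: octo
  assume "u \<in> Basis" "v \<in> Basis"
  then show "u \<bullet> v = (if u = v then 1 else 0)"
    by (auto simp: Basis_octo_def inner_octo_def inner_Basis split: if_splits)
next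
  fix x :: octo
  have "(\<forall>u\<in>Basis. x \<bullet> u = 0) \<longleftrightarrow> (\<forall>b\<in>Basis. oa x \<bullet> b = 0) \<and> (\<forall>b\<in>Basis. ob x \<bullet> b = 0)"
    by (simp add: Basis_octo_def inner_octo_def ball_Un)
  then show "(\<forall>u\<in>Basis. x \<bullet> u = 0) \<longleftrightarrow> x = 0"
    by (simp add: octo_eq_iff euclidean_all_zero_iff)
qed (auto simp: Basis_octo_def)

end

lemma DIM_octo: "DIM(octo) = 8"
proof -
  have "card ((\<lambda>b. Octo b 0) ` (Basis :: quat set) \<union> Octo 0 ` Basis) = 4 + 4"
    unfolding DIM_quat [symmetric]
    by (subst card_Un_disjoint) (auto simp: card_image inj_on_def)
  then show ?thesis
    by (simp add: Basis_octo_def)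
qed

text \<open>The product of octonions is the Cayley--Dickson double of the quaternionic one.\<close>

instantiation octo :: hypercomplex
begin

definition "1 = Octo 1 0"
definition "p * q = Octo
  (oa p * oa q - qcnj (ob q) * ob p)
  (ob q * oa p + ob p * qcnj (oa q))"
definition "hRe p = hRe (oa p)"

instance ..

end

lemma octo_norm_mult: "norm (p * q) = norm p * norm (q :: octo)"
  unfolding norm_octo_def real_sqrt_mult [symmetric] inner_octo_def inner_quat_def
    times_octo_def times_quat_def qcnj_def quat.sel octo.sel quat_sel_simps
  by (rule arg_cong [where f = sqrt]) (simp add: algebra_simps)


section \<open>Differentiability classes and diffeomorphisms\<close>

text \<open>\<open>Ck_on k S f\<close> is meant for open \<open>S\<close>; in finite dimension, continuity of all the
  directional derivatives amounts to continuity of the differential.\<close>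

primrec Ck_on :: "nat \<Rightarrow> 'a::euclidean_space set \<Rightarrow> ('a \<Rightarrow> 'b::euclidean_space) \<Rightarrow> bool" where
  "Ck_on 0 S f \<longleftrightarrow> continuous_on S f"
| "Ck_on (Suc k) S f \<longleftrightarrow>
     (\<forall>x\<in>S. f differentiable (at x)) \<and>
     (\<forall>v. Ck_on k S (\<lambda>x. frechet_derivative f (at x) v))"

text \<open>Smooth maps between arbitrary subsets of Euclidean spaces: those which extend locally to
  maps of class \<open>C\<^sup>\<infinity>\<close> on open sets.\<close>

definition smooth_map_on :: "'a::euclidean_space set \<Rightarrow> ('a \<Rightarrow> 'b::euclidean_space) \<Rightarrow> bool" where
  "smooth_map_on X g \<longleftrightarrow>
     (\<forall>x\<in>X. \<exists>U h. open U \<and> x \<in> U \<and> (\<forall>k. Ck_on k U h) \<and> (\<forall>y\<in>U \<inter> X. h y = g y))"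

definition diffeomorphic :: "'a::euclidean_space set \<Rightarrow> 'b::euclidean_space set \<Rightarrow> bool" where
  "diffeomorphic X Y \<longleftrightarrow>
     (\<exists>g h. smooth_map_on X g \<and> smooth_map_on Y h \<and> g ` X = Y \<and> h ` Y = X \<and>
        (\<forall>x\<in>X. h (g x) = x) \<and> (\<forall>y\<in>Y. g (h y) = y))"


section \<open>Slice conformal maps\<close>

definition imag_space :: "'a::hypercomplex set" where
  "imag_space = {q. hRe q = 0}"

definition imag_units :: "'a::hypercomplex set" where
  "imag_units = {I. I * I = - 1}"

definition slice :: "'a::hypercomplex \<Rightarrow> 'a set" where
  "slice I = {x *\<^sub>R 1 + y *\<^sub>R I | x y. True}"

definition slice_domain :: "'a::hypercomplex set \<Rightarrow> bool" where
  "slice_domain \<Omega> \<longleftrightarrow> open \<Omega> \<and> connected \<Omega> \<and> (\<exists>x. x *\<^sub>R 1 \<in> \<Omega>) \<and>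
     (\<forall>I\<in>imag_units.
        openin (top_of_set (slice I)) (\<Omega> \<inter> slice I) \<and> connected (\<Omega> \<inter> slice I) \<and>
        \<Omega> \<inter> slice I \<noteq> {})"

text \<open>The restriction of \<open>T\<close> to the linear subspace \<open>W\<close> satisfies \<open>T\<^sup>t T = k Id\<close> with \<open>k \<noteq> 0\<close>;
  here \<open>T'\<close> is the transpose of \<open>T : W \<rightarrow> 'b\<close>, hence takes values in \<open>W\<close>.\<close>

definition conformal_on :: "'a::euclidean_space set \<Rightarrow> ('a \<Rightarrow> 'b::euclidean_space) \<Rightarrow> bool" where
  "conformal_on W T \<longleftrightarrow> subspace W \<and> linear T \<and>
     (\<exists>T' k. linear T' \<and> range T' \<subseteq> W \<and> (\<forall>w\<in>W. \<forall>v. T w \<bullet> v = w \<bullet> T' v) \<and>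
        k \<noteq> 0 \<and> (\<forall>w\<in>W. T' (T w) = k *\<^sub>R w))"

text \<open>The target \<open>\<real>\<^sup>N\<close> is a linear subspace \<open>V\<close>, of dimension \<open>N\<close>, of the Euclidean
  space \<open>'b\<close>, with the induced scalar product. This covers targets like \<open>\<bbbK> \<times> Im \<bbbK>\<close>,
  which is \<open>UNIV \<times> imag_space\<close>. ``Slice isothermal'' is a synonym of ``slice conformal''.\<close>

definition slice_isothermal ::
    "'b::euclidean_space set \<Rightarrow> 'a::hypercomplex set \<Rightarrow> ('a \<Rightarrow> 'b) \<Rightarrow> bool" where
  "slice_isothermal V \<Omega> f \<longleftrightarrow>
     subspace V \<and> DIM('a) \<le> dim V \<and> slice_domain \<Omega> \<and> f ` \<Omega> \<subseteq> V \<and> Ck_on 1 \<Omega> f \<and>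
     (\<forall>I\<in>imag_units. \<forall>x y. x *\<^sub>R 1 + y *\<^sub>R I \<in> \<Omega> \<longrightarrow>
        conformal_on (slice I) (frechet_derivative f (at (x *\<^sub>R 1 + y *\<^sub>R I))) \<and>
        conformal_on (orthogonal_comp (slice I)) (frechet_derivative f (at (x *\<^sub>R 1 + y *\<^sub>R I))))"

definition slice_isothermal_parameterization ::
    "'b::euclidean_space set \<Rightarrow> 'a::hypercomplex set \<Rightarrow> ('a \<Rightarrow> 'b) \<Rightarrow> bool" where
  "slice_isothermal_parameterization V \<Omega> f \<longleftrightarrow>
     slice_isothermal V \<Omega> f \<and> inj_on f \<Omega> \<and> (\<forall>q\<in>\<Omega>. inj (frechet_derivative f (at q)))"

definition parameterized_hypercomplex_Riemann_manifold ::
    "'a::hypercomplex itself \<Rightarrow> 'b::euclidean_space set \<Rightarrow> 'b set \<Rightarrow> bool" where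
  "parameterized_hypercomplex_Riemann_manifold (_ :: 'a itself) V M \<longleftrightarrow>
     (\<exists>(\<Omega> :: 'a set) f. slice_isothermal_parameterization V \<Omega> f \<and> M = f ` \<Omega>)"


section \<open>The map of the theorem\<close>

text \<open>A point of the algebra has several representations \<open>x + I y\<close>, so that existence of a map
  with this property is not immediate.\<close>

definition sinh_slice_map :: "('a::hypercomplex \<Rightarrow> 'a \<times> 'a) \<Rightarrow> bool" where
  "sinh_slice_map f \<longleftrightarrow> (\<forall>I\<in>imag_units. \<forall>x y.
     f (x *\<^sub>R 1 + y *\<^sub>R I) = ((sinh x * cos y) *\<^sub>R 1 + (sinh x * sin y) *\<^sub>R I, y *\<^sub>R I))"

end

theory Submission
  imports Defs
begin

text \<open>
  Write \<open>q = x + v\<close> with \<open>v\<close> imaginary. The map is \<open>q \<mapsto> (sinh x \<cdot> exp v, v)\<close>, where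
  \<open>exp v = C(|v|\<^sup>2) + S(|v|\<^sup>2) v\<close> for the entire functions \<open>C\<close>, \<open>S\<close> with
  \<open>C(r\<^sup>2) = cos r\<close> and \<open>S(r\<^sup>2) = sin r / r\<close>; this removes the apparent singularity at
  \<open>v = 0\<close>. Since \<open>exp v\<close> is a unit vector, \<open>(p, v) \<mapsto> arsinh (p \<bullet> exp v) + v\<close> is a smooth left
  inverse defined on the whole ambient space. At \<open>x + I y\<close> the differential multiplies the
  scalar product by \<open>cosh\<^sup>2 x = sinh\<^sup>2 x + 1\<close> on \<open>\<complex>\<^sub>I\<close>, and by \<open>sinh\<^sup>2 x \<cdot> S(y\<^sup>2)\<^sup>2 + 1\<close> on its
  orthogonal complement.
\<close>

section \<open>Calculus of the classes \<open>C\<^sup>k\<close>\<close>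

text \<open>Uniqueness of the derivative identifies the chosen \<open>frechet_derivative\<close>
  with any explicit \<open>D\<close>. The domain is \<open>UNIV\<close> because all maps below are
  global.\<close>

lemma Ck_on_SucI:
  assumes "\<And>x. (f has_derivative D x) (at x)" "\<And>v. Ck_on k UNIV (\<lambda>x. D x v)"
  shows "Ck_on (Suc k) UNIV f"
proof -
  have "frechet_derivative f (at x) = D x" for x
    using frechet_derivative_at [OF assms(1)] by simp
  then show ?thesis
    using assms by (auto simp: differentiable_def)
qed

lemma Ck_on_SucD:
  assumes "Ck_on (Suc k) UNIV f"
  shows "(f has_derivative frechet_derivative f (at x)) (at x)"
    and "Ck_on k UNIV (\<lambda>x. frechet_derivative f (at x) v)"
  using assms by (simp_all add: frechet_derivative_works)

lemma Ck_on_imp_continuous_on: "Ck_on k UNIV f \<Longrightarrow> continuous_on UNIV f"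
  by (cases k) (auto simp: continuous_at_imp_continuous_on differentiable_imp_continuous_within)

text \<open>The induction descends to directional derivatives, so \<open>f\<close> has to vary; at
  the bottom, differentiability gives continuity.\<close>

lemma Ck_on_mono_Suc: "Ck_on (Suc k) UNIV f \<Longrightarrow> Ck_on k UNIV f"
proof (induction k arbitrary: f)
  case 0
  then show ?case using Ck_on_imp_continuous_on Ck_on.simps(1) by blast
next
  case (Suc k)
  show ?case
    by (rule Ck_on_SucI [OF Ck_on_SucD(1) [OF Suc.prems]])
      (rule Suc.IH [OF Ck_on_SucD(2) [OF Suc.prems]])
qed

lemma Ck_on_const: "Ck_on k UNIV (\<lambda>x. c)"
proof (induction k arbitrary: c)
  case (Suc k)
  show ?case by (rule Ck_on_SucI [OF has_derivative_const Suc.IH])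
qed simp

lemma Ck_on_bounded_linear: "bounded_linear L \<Longrightarrow> Ck_on k UNIV L"
  by (cases k)
    (auto simp del: Ck_on.simps(2) simp: linear_continuous_on
      intro: Ck_on_SucI [OF bounded_linear_imp_has_derivative Ck_on_const])

lemma Ck_on_add: "Ck_on k UNIV f \<Longrightarrow> Ck_on k UNIV g \<Longrightarrow> Ck_on k UNIV (\<lambda>x. f x + g x)"
proof (induction k arbitrary: f g)
  case (Suc k)
  show ?case
    by (rule Ck_on_SucI
        [OF has_derivative_add [OF Suc.prems [THEN Ck_on_SucD(1)]]
            Suc.IH [OF Suc.prems [THEN Ck_on_SucD(2)]]])
qed (simp add: continuous_on_add)

lemma Ck_on_sum:
  "(\<And>i. i \<in> A \<Longrightarrow> Ck_on k UNIV (f i)) \<Longrightarrow> Ck_on k UNIV (\<lambda>x. \<Sum>i\<in>A. f i x)"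
  by (induction A rule: infinite_finite_induct) (simp_all add: Ck_on_const Ck_on_add)

text \<open>By the Leibniz rule the derivative is a sum of two terms, each pairing a directional
  derivative with an undifferentiated factor whose order is lowered by one.\<close>

lemma Ck_on_bilinear:
  assumes "bounded_bilinear B"
  shows "Ck_on k UNIV f \<Longrightarrow> Ck_on k UNIV g \<Longrightarrow> Ck_on k UNIV (\<lambda>x. B (f x) (g x))"
proof (induction k arbitrary: f g)
  case 0
  then show ?case by (simp add: bounded_bilinear.continuous_on [OF assms])
next
  case (Suc k)
  show ?case
    by (rule Ck_on_SucI
        [OF bounded_bilinear.FDERIV [OF assms Suc.prems [THEN Ck_on_SucD(1)]]])
      (intro Ck_on_add Suc.IH Suc.prems [THEN Ck_on_SucD(2)] Suc.prems [THEN Ck_on_mono_Suc])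
qed

lemmas Ck_on_scaleR = Ck_on_bilinear [OF bounded_bilinear_scaleR]
lemmas Ck_on_mult = Ck_on_bilinear [OF bounded_bilinear_mult]
lemmas Ck_on_inner = Ck_on_bilinear [OF bounded_bilinear_inner]

lemma Ck_on_compose:
  "Ck_on k UNIV g \<Longrightarrow> Ck_on k UNIV f \<Longrightarrow> Ck_on k UNIV (\<lambda>x. g (f x))"
proof (induction k arbitrary: g)
  case 0
  then show ?case by (simp add: continuous_on_compose2)
next
  case (Suc k)
  let ?D = "\<lambda>f x. frechet_derivative f (at x)"
  \<comment> \<open>\<open>Ck_on\<close> speaks of fixed directions only, while here the direction
    varies with \<open>x\<close>; expanding it in the basis leaves fixed directions with varying
    coefficients.\<close>
  have "?D g (f x) (?D f x v) = (\<Sum>b\<in>Basis. (?D f x v \<bullet> b) *\<^sub>R ?D g (f x) b)" for x v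
  proof -
    have lin: "linear (?D g (f x))"
      using Ck_on_SucD(1) [OF Suc.prems(1)] by (rule has_derivative_linear)
    have "?D g (f x) (?D f x v) = ?D g (f x) (\<Sum>b\<in>Basis. (?D f x v \<bullet> b) *\<^sub>R b)"
      by (simp only: euclidean_representation)
    also have "\<dots> = (\<Sum>b\<in>Basis. (?D f x v \<bullet> b) *\<^sub>R ?D g (f x) b)"
      by (simp add: linear_sum [OF lin] linear_cmul [OF lin])
    finally show ?thesis .
  qed
  moreover have "Ck_on k UNIV (\<lambda>x. ?D g (f x) b)" for b
    by (rule Suc.IH [OF Suc.prems(1) [THEN Ck_on_SucD(2)] Ck_on_mono_Suc [OF Suc.prems(2)]])
  ultimately have "Ck_on k UNIV (\<lambda>x. ?D g (f x) (?D f x v))" for v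
    using Suc.prems(2) by (simp only:) (intro Ck_on_sum Ck_on_scaleR Ck_on_inner Ck_on_const Ck_on_SucD(2))
  with has_derivative_compose [OF Suc.prems(2,1) [THEN Ck_on_SucD(1)]] show ?case
    by (rule Ck_on_SucI)
qed

text \<open>A pair is the sum of the images of its components under two linear embeddings.\<close>

lemma Ck_on_Pair:
  assumes "Ck_on k UNIV f" "Ck_on k UNIV g"
  shows "Ck_on k UNIV (\<lambda>x. (f x, g x))"
proof -
  have "bounded_linear (\<lambda>x::'b. (x, 0::'c))" "bounded_linear (\<lambda>y::'c. (0::'b, y))"
    by (intro bounded_linear_Pair bounded_linear_ident bounded_linear_zero)+
  then have "Ck_on k UNIV (\<lambda>x. (f x, 0) + (0, g x))"
    by (intro Ck_on_add Ck_on_compose [OF Ck_on_bounded_linear assms(1)]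
        Ck_on_compose [OF Ck_on_bounded_linear assms(2)])
  then show ?thesis by simp
qed

section \<open>Power series and hyperbolic functions\<close>

lemma Ck_on_Suc_real:
  fixes f :: "real \<Rightarrow> real"
  assumes "\<And>x. (f has_real_derivative f' x) (at x)" "Ck_on k UNIV f'"
  shows "Ck_on (Suc k) UNIV f"
  using assms by (intro Ck_on_SucI [where D = "\<lambda>x. (*) (f' x)"] Ck_on_mult Ck_on_const)
    (auto simp: has_field_derivative_def)

text \<open>Termwise differentiation gives another everywhere convergent power series, hence the
  induction over all coefficient sequences.\<close>

lemma Ck_on_powser:
  fixes c :: "nat \<Rightarrow> real"
  assumes "\<And>x. summable (\<lambda>n. c n * x ^ n)"
  shows "Ck_on k UNIV (\<lambda>x. \<Sum>n. c n * x ^ n)"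
  using assms
proof (induction k arbitrary: c)
  case 0
  then show ?case
    by (auto intro!: continuous_at_imp_continuous_on isCont_powser_converges_everywhere)
next
  case (Suc k)
  show ?case
    by (rule Ck_on_Suc_real [OF termdiffs_strong_converges_everywhere [OF Suc.prems]
          Suc.IH [OF termdiff_converges_all [OF Suc.prems]]])
qed

text \<open>Each function is the derivative of the other, so the induction treats both at
  once.\<close>

lemma Ck_on_sinh_cosh:
  "Ck_on k UNIV (sinh :: real \<Rightarrow> real) \<and> Ck_on k UNIV (cosh :: real \<Rightarrow> real)"
proof (induction k)
  case (Suc k)
  have "(sinh has_real_derivative cosh x) (at x)" "(cosh has_real_derivative sinh x) (at x)"
    for x :: real
    by (auto intro!: derivative_eq_intros)
  with Suc show ?case
    using Ck_on_Suc_real by blast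
qed (auto intro!: continuous_intros)

lemmas Ck_on_sinh = Ck_on_sinh_cosh [THEN conjunct1]

text \<open>The derivative \<open>u\<close> of \<open>arsinh\<close> satisfies \<open>u' = - x u\<^sup>3\<close>, hence is as smooth as one likes.\<close>

lemma Ck_on_arsinh: "Ck_on k UNIV (arsinh :: real \<Rightarrow> real)"
proof -
  let ?u = "\<lambda>x::real. 1 / sqrt (x\<^sup>2 + 1)"
  have pos: "0 < x\<^sup>2 + 1" for x :: real
    by (simp add: add_nonneg_pos)
  have "Ck_on k UNIV ?u"
  proof (induction k)
    case 0
    show ?case
      by (simp, intro continuous_intros ballI) (use pos in \<open>simp add: less_imp_neq [symmetric]\<close>)
  next
    case (Suc k)
    have "(?u has_real_derivative - (x * (?u x * (?u x * ?u x)))) (at x)" for x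
    proof -
      have "sqrt (x\<^sup>2 + 1) \<noteq> 0"
        using pos [of x] by simp
      have "((\<lambda>x. sqrt (x\<^sup>2 + 1)) has_real_derivative x / sqrt (x\<^sup>2 + 1)) (at x)"
        using pos [of x] by (auto intro!: derivative_eq_intros simp: field_simps)
      from DERIV_inverse_fun [OF this \<open>sqrt (x\<^sup>2 + 1) \<noteq> 0\<close>] show ?thesis
        by (simp add: inverse_eq_divide power2_eq_square mult_ac)
    qed
    moreover have "Ck_on k UNIV (\<lambda>x. - (x * (?u x * (?u x * ?u x))))"
      by (intro Ck_on_compose [OF Ck_on_bounded_linear [OF bounded_linear_minus [OF bounded_linear_ident]]]
          Ck_on_mult Suc Ck_on_bounded_linear bounded_linear_ident)
    ultimately show ?case by (rule Ck_on_Suc_real)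
  qed
  then have "Ck_on (Suc k) UNIV (arsinh :: real \<Rightarrow> real)"
    by (intro Ck_on_Suc_real [OF arsinh_real_has_field_derivative])
  then show ?thesis by (rule Ck_on_mono_Suc)
qed

text \<open>The global map itself serves as the local smooth extension, whatever the shape of
  \<open>X\<close>.\<close>

lemma smooth_map_on_UNIV_subset: "(\<And>k. Ck_on k UNIV f) \<Longrightarrow> smooth_map_on X f"
  unfolding smooth_map_on_def by (intro ballI exI [of _ UNIV] exI [of _ f]) simp

section \<open>Entire functions with \<open>cos r = C(r\<^sup>2)\<close> and \<open>sin r = r S(r\<^sup>2)\<close>\<close>

definition cos_sqrt :: "real \<Rightarrow> real" where
  "cos_sqrt s = (\<Sum>n. ((- 1) ^ n / fact (2 * n)) * s ^ n)"

definition sinc_sqrt :: "real \<Rightarrow> real" where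
  "sinc_sqrt s = (\<Sum>n. ((- 1) ^ n / fact (2 * n + 1)) * s ^ n)"

text \<open>Every \<open>x\<close> lies strictly inside the disc of radius
  \<open>\<bar>x\<bar> + 1\<close>, which is a nonzero square. Asking for
  \<open>r \<noteq> 0\<close> only permits dividing the sine series by \<open>r\<close>.\<close>

lemma summable_powser_everywhere:
  fixes c :: "nat \<Rightarrow> real"
  assumes "\<And>r. r \<noteq> 0 \<Longrightarrow> summable (\<lambda>n. c n * (r\<^sup>2) ^ n)"
  shows "summable (\<lambda>n. c n * x ^ n)"
proof -
  have "sqrt (\<bar>x\<bar> + 1) \<noteq> 0" by simp
  from assms [OF this] have "summable (\<lambda>n. c n * (\<bar>x\<bar> + 1) ^ n)" by simp
  then show ?thesis by (rule powser_inside) simp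
qed

lemma summable_cos_sqrt: "summable (\<lambda>n. ((- 1) ^ n / fact (2 * n)) * x ^ n)" for x :: real
  by (rule summable_powser_everywhere)
    (use cos_paired [THEN sums_summable] in \<open>simp add: power_mult\<close>)

lemma summable_sinc_sqrt: "summable (\<lambda>n. ((- 1) ^ n / fact (2 * n + 1)) * x ^ n)" for x :: real
proof (rule summable_powser_everywhere)
  fix r :: real assume "r \<noteq> 0"
  then show "summable (\<lambda>n. ((- 1) ^ n / fact (2 * n + 1)) * (r\<^sup>2) ^ n)"
    using summable_mult2 [OF sin_paired [THEN sums_summable], of r "1 / r"]
    by (simp add: power_mult)
qed

lemma cos_sqrt_square: "cos_sqrt (r\<^sup>2) = cos r"
  unfolding cos_sqrt_def using cos_paired [of r] by (simp add: sums_iff power_mult)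

lemma sinc_sqrt_square: "sinc_sqrt (r\<^sup>2) * r = sin r"
proof -
  have "(\<lambda>n. ((- 1) ^ n / fact (2 * n + 1)) * (r\<^sup>2) ^ n * r) sums (sinc_sqrt (r\<^sup>2) * r)"
    unfolding sinc_sqrt_def by (intro sums_mult2 summable_sums summable_sinc_sqrt)
  then have "(\<lambda>n. (- 1) ^ n / fact (2 * n + 1) * r ^ (2 * n + 1)) sums (sinc_sqrt (r\<^sup>2) * r)"
    by (simp add: power_mult [symmetric] mult_ac)
  then show ?thesis using sin_paired sums_unique2 by blast
qed

lemma Ck_on_cos_sqrt: "Ck_on k UNIV cos_sqrt"
  unfolding cos_sqrt_def by (rule Ck_on_powser [OF summable_cos_sqrt])

lemma Ck_on_sinc_sqrt: "Ck_on k UNIV sinc_sqrt"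
  unfolding sinc_sqrt_def by (rule Ck_on_powser [OF summable_sinc_sqrt])

lemma differentiable_cos_sqrt: "cos_sqrt field_differentiable (at s)"
  unfolding cos_sqrt_def field_differentiable_def
  using termdiffs_strong_converges_everywhere [OF summable_cos_sqrt] by blast

lemma differentiable_sinc_sqrt: "sinc_sqrt field_differentiable (at s)"
  unfolding sinc_sqrt_def field_differentiable_def
  using termdiffs_strong_converges_everywhere [OF summable_sinc_sqrt] by blast

lemma DERIV_square: "((\<lambda>y. y\<^sup>2) has_real_derivative 2 * y) (at y)"
  by (auto intro!: derivative_eq_intros)

text \<open>Differentiate \<open>cos_sqrt (y\<^sup>2) = cos y\<close> in \<open>y\<close> by the
  chain rule and compare; the series need not be touched.\<close>

lemma deriv_cos_sqrt_square: "deriv cos_sqrt (y\<^sup>2) * (2 * y) = - sin y"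
proof -
  have "((\<lambda>y. cos_sqrt (y\<^sup>2)) has_real_derivative deriv cos_sqrt (y\<^sup>2) * (2 * y)) (at y)"
    using differentiable_cos_sqrt
    by (intro DERIV_chain2 [where f = cos_sqrt] DERIV_square)
      (simp add: DERIV_deriv_iff_field_differentiable)
  then show ?thesis
    unfolding cos_sqrt_square using DERIV_cos DERIV_unique by blast
qed

text \<open>Likewise from \<open>sinc_sqrt (y\<^sup>2) * y = sin y\<close>, now with the product
  rule.\<close>

lemma deriv_sinc_sqrt_square:
  "deriv sinc_sqrt (y\<^sup>2) * (2 * y) * y + sinc_sqrt (y\<^sup>2) = cos y"
proof -
  have "((\<lambda>y. sinc_sqrt (y\<^sup>2)) has_real_derivative deriv sinc_sqrt (y\<^sup>2) * (2 * y)) (at y)"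
    using differentiable_sinc_sqrt
    by (intro DERIV_chain2 [where f = sinc_sqrt] DERIV_square)
      (simp add: DERIV_deriv_iff_field_differentiable)
  from DERIV_mult [OF this DERIV_ident]
  have "((\<lambda>y. sinc_sqrt (y\<^sup>2) * y) has_real_derivative
      deriv sinc_sqrt (y\<^sup>2) * (2 * y) * y + sinc_sqrt (y\<^sup>2)) (at y)"
    by (simp add: mult_ac)
  then show ?thesis
    unfolding sinc_sqrt_square using DERIV_sin DERIV_unique by blast
qed

section \<open>Conformal linear maps\<close>

text \<open>Scaling of scalar products by \<open>k\<close> is the usable criterion; the work lies in
  producing a transpose with values in \<open>W\<close>.\<close>

lemma conformal_onI:
  fixes T :: "'a::euclidean_space \<Rightarrow> 'b::euclidean_space"
  assumes W: "subspace W" and T: "linear T" and k: "k \<noteq> 0"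
    and inner: "\<And>w w'. w \<in> W \<Longrightarrow> w' \<in> W \<Longrightarrow> T w \<bullet> T w' = k * (w \<bullet> w')"
  shows "conformal_on W T"
proof -
  obtain B where B: "B \<subseteq> W" "pairwise orthogonal B" "\<And>b. b \<in> B \<Longrightarrow> norm b = 1"
    "independent B" "span B = W"
    using orthonormal_basis_subspace [OF W] by metis
  have "finite B"
    using B(4) by (rule independent_imp_finite)
  have expand: "(\<Sum>b\<in>B. (w \<bullet> b) *\<^sub>R b) = w" if "w \<in> W" for w
    using orthonormal_basis_expand [OF B(2,3)] that \<open>span B = W\<close> \<open>finite B\<close> by simp
  \<comment> \<open>This is the adjoint of \<open>T\<close> followed by the orthogonal projection
    onto \<open>W\<close>, written in the orthonormal basis \<open>B\<close> of
    \<open>W\<close>.\<close>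
  define T' where "T' v = (\<Sum>b\<in>B. (v \<bullet> T b) *\<^sub>R b)" for v
  have "linear T'"
    unfolding T'_def
    by (intro linear_compose_sum ballI linearI) (simp_all add: inner_add_left scaleR_add_left)
  moreover have "range T' \<subseteq> W"
    unfolding T'_def using B(1) W by (auto intro!: subspace_sum subspace_scale)
  moreover have "T w \<bullet> v = w \<bullet> T' v" if "w \<in> W" for w v
  proof -
    have "T w \<bullet> v = T (\<Sum>b\<in>B. (w \<bullet> b) *\<^sub>R b) \<bullet> v"
      by (simp only: expand [OF that])
    also have "\<dots> = w \<bullet> T' v"
      by (simp add: T'_def linear_sum [OF T] linear_cmul [OF T] inner_sum_left inner_sum_right
          inner_commute mult.commute)
    finally show ?thesis .
  qed
  moreover have "T' (T w) = k *\<^sub>R w" if "w \<in> W" for w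
  proof -
    have "T' (T w) = (\<Sum>b\<in>B. (k * (w \<bullet> b)) *\<^sub>R b)"
      unfolding T'_def using that B(1) by (intro sum.cong) (auto simp: inner)
    also have "\<dots> = k *\<^sub>R (\<Sum>b\<in>B. (w \<bullet> b) *\<^sub>R b)"
      by (simp add: scaleR_sum_right)
    finally show ?thesis
      by (simp only: expand [OF that])
  qed
  ultimately show ?thesis
    unfolding conformal_on_def using W T k by blast
qed

section \<open>Slices of quaternions and octonions\<close>

text \<open>Gathers what is needed of the product so that quaternions and octonions share one proof;
  no associativity is assumed.\<close>

class slice_algebra = hypercomplex +
  assumes hRe_eq_inner: "hRe q = q \<bullet> 1"
    and norm_hone: "norm 1 = 1"
    and square_eq_minus_one_iff: "q * q = - 1 \<longleftrightarrow> hRe q = 0 \<and> norm q = 1"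
    and ex_square_eq_minus_one: "\<exists>q. q * q = - 1"

instance quat :: slice_algebra
proof
  fix q :: quat
  show "hRe q = q \<bullet> 1"
    by (simp add: hRe_quat_def inner_quat_def one_quat_def)
  show "norm (1 :: quat) = 1"
    by (simp add: norm_quat_def inner_quat_def one_quat_def)
  show "q * q = - 1 \<longleftrightarrow> hRe q = 0 \<and> norm q = 1"
  proof
    assume "q * q = - 1"
    then have *: "qa q * qa q - qb q * qb q - qc q * qc q - qd q * qd q = - 1"
      "qa q * qb q = 0" "qa q * qc q = 0" "qa q * qd q = 0"
      by (auto simp: quat_eq_iff times_quat_def one_quat_def)
    \<comment> \<open>A nonzero real part would kill the three imaginary components and leave a real
      square root of -1.\<close>
    have "qa q = 0"
    proof (rule ccontr)
      assume "qa q \<noteq> 0"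
      with * have "qa q * qa q = - 1" by simp
      then show False using zero_le_square [of "qa q"] by linarith
    qed
    with * show "hRe q = 0 \<and> norm q = 1"
      by (simp add: hRe_quat_def norm_quat_def inner_quat_def)
  next
    assume "hRe q = 0 \<and> norm q = 1"
    then show "q * q = - 1"
      by (auto simp: hRe_quat_def norm_quat_def inner_quat_def quat_eq_iff times_quat_def
          one_quat_def)
  qed
  show "\<exists>q :: quat. q * q = - 1"
    by (rule exI [of _ "Quat 0 1 0 0"]) (simp add: quat_eq_iff times_quat_def one_quat_def)
qed

instance octo :: slice_algebra
proof
  fix q :: octo
  show "hRe q = q \<bullet> 1"
    by (simp add: hRe_octo_def hRe_eq_inner inner_octo_def one_octo_def)
  show "norm (1 :: octo) = 1"
    using norm_hone [where 'a = quat] by (simp add: norm_octo_def norm_quat_def inner_octo_def one_octo_def)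
  \<comment> \<open>The mixed terms of the doubled product combine to twice the real part, and the
    norm of the second half enters the first; this reduces the claim to quaternions.\<close>
  have square: "q * q = Octo (oa q * oa q - (ob q \<bullet> ob q) *\<^sub>R 1) ((2 * qa (oa q)) *\<^sub>R ob q)"
    by (simp add: times_octo_def quat_eq_iff times_quat_def qcnj_def one_quat_def inner_quat_def
        algebra_simps)
  show "q * q = - 1 \<longleftrightarrow> hRe q = 0 \<and> norm q = 1"
  proof
    assume "q * q = - 1"
    then have *: "oa q * oa q - (ob q \<bullet> ob q) *\<^sub>R 1 = - 1" "qa (oa q) = 0 \<or> ob q = 0"
      unfolding square by (simp_all add: octo_eq_iff one_octo_def)
    have "qa (oa q) = 0"
    proof (rule ccontr)
      assume "qa (oa q) \<noteq> 0"
      \<comment> \<open>Here \<open>ob q = 0\<close>, so \<open>oa q\<close> is a quaternionic root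
        of -1, whose real part must vanish.\<close>
      with * have "oa q * oa q = - 1" by simp
      then show False
        using \<open>qa (oa q) \<noteq> 0\<close> by (simp add: square_eq_minus_one_iff hRe_quat_def)
    qed
    with * show "hRe q = 0 \<and> norm q = 1"
      by (simp add: hRe_octo_def hRe_quat_def norm_octo_def inner_octo_def inner_quat_def
          quat_eq_iff times_quat_def one_quat_def)
  next
    assume "hRe q = 0 \<and> norm q = 1"
    then show "q * q = - 1"
      unfolding square
      by (auto simp: hRe_octo_def hRe_quat_def norm_octo_def inner_octo_def inner_quat_def
          octo_eq_iff quat_eq_iff times_quat_def one_quat_def one_octo_def)
  qed
  obtain r :: quat where "r * r = - 1"
    using ex_square_eq_minus_one by blast
  then have "hRe r = 0" "norm r = 1"
    by (simp_all add: square_eq_minus_one_iff)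
  then have "Octo r 0 * Octo r 0 = - 1"
    using \<open>r * r = - 1\<close>
    by (simp add: times_octo_def octo_eq_iff one_octo_def times_quat_def quat_eq_iff qcnj_def)
  then show "\<exists>q :: octo. q * q = - 1" ..
qed

section \<open>Imaginary units and the decomposition into real and imaginary parts\<close>

lemma inner_one_one: "(1::'a::slice_algebra) \<bullet> 1 = 1"
  using norm_hone by (simp add: norm_eq_1)

text \<open>Trades the product for the scalar product: \<open>1\<close> and \<open>I\<close> become
  an orthonormal pair, and slices can be handled by Euclidean geometry.\<close>

lemma mem_imag_units_iff:
  "(I::'a::slice_algebra) \<in> imag_units \<longleftrightarrow> I \<bullet> 1 = 0 \<and> I \<bullet> I = 1"
  by (simp add: imag_units_def square_eq_minus_one_iff hRe_eq_inner norm_eq_1)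

definition im_part :: "'a::hypercomplex \<Rightarrow> 'a" where
  "im_part q = q - hRe q *\<^sub>R 1"

lemma im_part_eq: "im_part (q::'a::slice_algebra) = q - (q \<bullet> 1) *\<^sub>R 1"
  by (simp add: im_part_def hRe_eq_inner)

lemma inner_im_part_one: "im_part (q::'a::slice_algebra) \<bullet> 1 = 0"
  by (simp add: im_part_eq inner_diff_left inner_one_one)

lemma bounded_linear_im_part: "bounded_linear (im_part :: 'a::slice_algebra \<Rightarrow> 'a)"
  unfolding im_part_eq
  by (intro bounded_linear_sub bounded_linear_ident bounded_linear_scaleR_const
      bounded_linear_inner_left)

lemma hRe_slice:
  "I \<in> imag_units \<Longrightarrow> hRe (x *\<^sub>R 1 + y *\<^sub>R (I::'a::slice_algebra)) = x"
  by (simp add: hRe_eq_inner mem_imag_units_iff inner_add_left inner_one_one)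

lemma im_part_slice:
  "I \<in> imag_units \<Longrightarrow> im_part (x *\<^sub>R 1 + y *\<^sub>R (I::'a::slice_algebra)) = y *\<^sub>R I"
  by (simp add: im_part_def hRe_slice)

lemma imag_eq_scaleR_unit:
  fixes v :: "'a::slice_algebra"
  assumes "v \<bullet> 1 = 0"
  obtains y I where "I \<in> imag_units" "v = y *\<^sub>R I"
proof (cases "v = 0")
  case True
  \<comment> \<open>The zero vector has no direction, so any unit is taken, with coefficient
    0.\<close>
  obtain I :: 'a where "I \<in> imag_units"
    using ex_square_eq_minus_one unfolding imag_units_def by blast
  with True that [of I 0] show ?thesis by simp
next
  case False
  then have "(1 / norm v) *\<^sub>R v \<in> imag_units"
    using assms by (simp add: mem_imag_units_iff dot_square_norm power2_eq_square)
  with False that [of _ "norm v"] show ?thesis by simp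
qed

lemma slice_decomposition:
  fixes q :: "'a::slice_algebra"
  obtains x y I where "I \<in> imag_units" "q = x *\<^sub>R 1 + y *\<^sub>R I"
proof -
  obtain y I where "I \<in> imag_units" "im_part q = y *\<^sub>R I"
    using inner_im_part_one by (rule imag_eq_scaleR_unit)
  with that [of I "hRe q" y] show ?thesis
    by (simp add: im_part_def algebra_simps)
qed

lemma subspace_slice: "subspace (slice I)"
  unfolding slice_def subspace_def
proof (intro conjI ballI allI)
  show "0 \<in> {x *\<^sub>R 1 + y *\<^sub>R I |x y. True}"
    by (auto intro!: exI [of _ 0])
next
  fix p q assume "p \<in> {x *\<^sub>R 1 + y *\<^sub>R I |x y. True}" "q \<in> {x *\<^sub>R 1 + y *\<^sub>R I |x y. True}"
  then obtain x y x' y' where "p = x *\<^sub>R 1 + y *\<^sub>R I" "q = x' *\<^sub>R 1 + y' *\<^sub>R I" by blast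
  then have "p + q = (x + x') *\<^sub>R 1 + (y + y') *\<^sub>R I" by (simp add: algebra_simps)
  then show "p + q \<in> {x *\<^sub>R 1 + y *\<^sub>R I |x y. True}" by blast
next
  fix c q assume "q \<in> {x *\<^sub>R 1 + y *\<^sub>R I |x y. True}"
  then obtain x y where "q = x *\<^sub>R 1 + y *\<^sub>R I" by blast
  then have "c *\<^sub>R q = (c * x) *\<^sub>R 1 + (c * y) *\<^sub>R I" by (simp add: algebra_simps)
  then show "c *\<^sub>R q \<in> {x *\<^sub>R 1 + y *\<^sub>R I |x y. True}" by blast
qed

lemma slice_domain_UNIV: "slice_domain UNIV"
  unfolding slice_domain_def
  using subspace_slice [THEN subspace_imp_convex, THEN convex_connected] subspace_0 [OF subspace_slice]
  by auto

lemma subspace_UNIV_Times_imag_space: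
  "subspace (UNIV \<times> (imag_space :: 'a::slice_algebra set))"
proof (rule subspace_Times)
  show "subspace (imag_space :: 'a set)"
    by (auto simp: subspace_def imag_space_def hRe_eq_inner inner_add_left)
qed simp

text \<open>The first factor alone already contains a copy of the whole algebra.\<close>

lemma DIM_le_dim_UNIV_Times_imag_space:
  "DIM('a::slice_algebra) \<le> dim ((UNIV :: 'a set) \<times> (imag_space :: 'a set))"
proof -
  have "linear (\<lambda>x::'a. (x, 0::'a))" "inj (\<lambda>x::'a. (x, 0::'a))"
    by (auto intro!: linearI inj_onI)
  then have "DIM('a) = dim (range (\<lambda>x::'a. (x, 0::'a)))"
    by (simp add: dim_image_eq)
  also have "\<dots> \<le> dim ((UNIV :: 'a set) \<times> (imag_space :: 'a set))"
    by (intro dim_subset) (auto simp: imag_space_def hRe_eq_inner)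
  finally show ?thesis .
qed

section \<open>The exponential of imaginary elements and its differential\<close>

definition imag_exp :: "'a::hypercomplex \<Rightarrow> 'a" where
  "imag_exp v = cos_sqrt (v \<bullet> v) *\<^sub>R 1 + sinc_sqrt (v \<bullet> v) *\<^sub>R v"

lemma imag_exp_unit:
  fixes I :: "'a::slice_algebra"
  assumes "I \<in> imag_units"
  shows "imag_exp (y *\<^sub>R I) = cos y *\<^sub>R 1 + sin y *\<^sub>R I"
  using assms cos_sqrt_square [of y] sinc_sqrt_square [of y]
  by (simp add: imag_exp_def mem_imag_units_iff power2_eq_square)

text \<open>On the slice through \<open>v\<close> this is
  \<open>(cos y)\<^sup>2 + (sin y)\<^sup>2 = 1\<close>; \<open>v\<close> must be imaginary for
  \<open>1\<close> and \<open>I\<close> to be orthogonal.\<close>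

lemma inner_imag_exp_self:
  fixes v :: "'a::slice_algebra"
  assumes "v \<bullet> 1 = 0"
  shows "imag_exp v \<bullet> imag_exp v = 1"
proof -
  obtain y I where I: "I \<in> imag_units" and v: "v = y *\<^sub>R I"
    using assms by (rule imag_eq_scaleR_unit)
  show ?thesis
    using I sin_cos_squared_add3 [of y] unfolding v imag_exp_unit [OF I]
    by (simp add: mem_imag_units_iff inner_add_left inner_add_right inner_one_one inner_commute)
qed

definition imag_exp_deriv :: "'a::hypercomplex \<Rightarrow> 'a \<Rightarrow> 'a" where
  "imag_exp_deriv v u = (deriv cos_sqrt (v \<bullet> v) * (2 * (v \<bullet> u))) *\<^sub>R 1
     + (deriv sinc_sqrt (v \<bullet> v) * (2 * (v \<bullet> u))) *\<^sub>R v + sinc_sqrt (v \<bullet> v) *\<^sub>R u"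

lemma has_derivative_imag_exp:
  "(imag_exp has_derivative imag_exp_deriv v) (at (v::'a::hypercomplex))"
proof -
  have *: "((\<lambda>v. g (v \<bullet> v)) has_derivative (\<lambda>u. deriv g (v \<bullet> v) * (2 * (v \<bullet> u)))) (at v)"
    if "g field_differentiable at (v \<bullet> v)" for g :: "real \<Rightarrow> real"
  proof -
    have "((\<lambda>v. v \<bullet> v) has_derivative (\<lambda>u. 2 * (v \<bullet> u))) (at v)"
      by (rule has_derivative_eq_rhs [OF has_derivative_inner [OF has_derivative_ident has_derivative_ident]])
        (simp add: inner_commute)
    moreover have "(g has_derivative (*) (deriv g (v \<bullet> v))) (at (v \<bullet> v))"
      using that by (simp add: DERIV_deriv_iff_field_differentiable [symmetric] has_field_derivative_def)
    ultimately show ?thesis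
      by (rule has_derivative_compose)
  qed
  have "((\<lambda>v. cos_sqrt (v \<bullet> v) *\<^sub>R 1 + sinc_sqrt (v \<bullet> v) *\<^sub>R v) has_derivative imag_exp_deriv v) (at v)"
    unfolding imag_exp_deriv_def
    by (rule has_derivative_eq_rhs [OF has_derivative_add
          [OF has_derivative_scaleR_left [OF * [OF differentiable_cos_sqrt]]
            has_derivative_scaleR [OF * [OF differentiable_sinc_sqrt] has_derivative_ident]]])
      (simp add: algebra_simps)
  then show ?thesis
    by (simp add: imag_exp_def [abs_def])
qed

text \<open>Along the slice the differential is that of \<open>cos y + I sin y\<close>, by the two
  identities for the derivatives at \<open>y\<^sup>2\<close>.\<close>

lemma imag_exp_deriv_unit:
  fixes I :: "'a::slice_algebra"
  assumes "I \<in> imag_units"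
  shows "imag_exp_deriv (y *\<^sub>R I) (b *\<^sub>R I) = b *\<^sub>R (- sin y *\<^sub>R 1 + cos y *\<^sub>R I)"
proof -
  have "imag_exp_deriv (y *\<^sub>R I) (b *\<^sub>R I) = b *\<^sub>R ((deriv cos_sqrt (y\<^sup>2) * (2 * y)) *\<^sub>R 1
      + (deriv sinc_sqrt (y\<^sup>2) * (2 * y) * y + sinc_sqrt (y\<^sup>2)) *\<^sub>R I)"
    using assms by (simp add: imag_exp_deriv_def mem_imag_units_iff power2_eq_square algebra_simps)
  then show ?thesis
    by (simp only: deriv_cos_sqrt_square deriv_sinc_sqrt_square)
qed

text \<open>In a direction orthogonal to \<open>v\<close> the quantity \<open>v \<bullet> v\<close>
  is stationary, so both coefficient functions have derivative 0.\<close>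

lemma imag_exp_deriv_orthogonal:
  "v \<bullet> u = 0 \<Longrightarrow> imag_exp_deriv v u = sinc_sqrt (v \<bullet> v) *\<^sub>R u"
  by (simp add: imag_exp_deriv_def)

lemma Ck_on_imag_exp: "Ck_on k UNIV (imag_exp :: 'a::hypercomplex \<Rightarrow> 'a)"
proof -
  have id: "Ck_on k UNIV (\<lambda>v::'a. v)"
    by (rule Ck_on_bounded_linear [OF bounded_linear_ident])
  show ?thesis
    unfolding imag_exp_def [abs_def]
    by (intro Ck_on_add Ck_on_scaleR Ck_on_const id Ck_on_inner
        Ck_on_compose [OF Ck_on_cos_sqrt] Ck_on_compose [OF Ck_on_sinc_sqrt])
qed

section \<open>The map and its inverse\<close>

definition slice_sinh :: "'a::hypercomplex \<Rightarrow> 'a \<times> 'a" where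
  "slice_sinh q = (sinh (hRe q) *\<^sub>R imag_exp (im_part q), im_part q)"

definition slice_arsinh :: "'a::hypercomplex \<times> 'a \<Rightarrow> 'a" where
  "slice_arsinh z = arsinh (fst z \<bullet> imag_exp (im_part (snd z))) *\<^sub>R 1 + im_part (snd z)"

text \<open>Existence: \<open>slice_sinh\<close> satisfies the formula for every representation of a
  point, so the formula is consistent. Uniqueness: every point has such a representation.\<close>

lemma sinh_slice_map_iff: "sinh_slice_map f \<longleftrightarrow> f = (slice_sinh :: 'a::slice_algebra \<Rightarrow> _)"
proof -
  have "slice_sinh (x *\<^sub>R 1 + y *\<^sub>R I) =
      ((sinh x * cos y) *\<^sub>R 1 + (sinh x * sin y) *\<^sub>R I, y *\<^sub>R I)"
    if "I \<in> imag_units" for x y and I :: 'a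
    using that by (simp add: slice_sinh_def hRe_slice im_part_slice imag_exp_unit scaleR_add_right)
  then show ?thesis
    unfolding sinh_slice_map_def fun_eq_iff by (metis slice_decomposition)
qed

lemma slice_arsinh_slice_sinh: "slice_arsinh (slice_sinh q) = (q::'a::slice_algebra)"
proof -
  have "im_part (im_part q) = im_part q"
    by (simp add: im_part_eq [of "im_part q"] inner_im_part_one)
  then show ?thesis
    by (simp add: slice_arsinh_def slice_sinh_def inner_imag_exp_self inner_im_part_one
        arsinh_sinh_real) (simp add: im_part_def)
qed

lemma Ck_on_slice_sinh: "Ck_on k UNIV (slice_sinh :: 'a::slice_algebra \<Rightarrow> _)"
proof -
  have "Ck_on k UNIV (im_part :: 'a \<Rightarrow> 'a)" "Ck_on k UNIV (hRe :: 'a \<Rightarrow> real)"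
    unfolding hRe_eq_inner [abs_def]
    by (intro Ck_on_bounded_linear bounded_linear_im_part bounded_linear_inner_left)+
  then show ?thesis
    unfolding slice_sinh_def [abs_def]
    by (intro Ck_on_Pair Ck_on_scaleR Ck_on_compose [OF Ck_on_sinh] Ck_on_compose [OF Ck_on_imag_exp])
qed

lemma Ck_on_slice_arsinh: "Ck_on k UNIV (slice_arsinh :: 'a::slice_algebra \<times> 'a \<Rightarrow> 'a)"
proof -
  have fst: "Ck_on k UNIV (fst :: 'a \<times> 'a \<Rightarrow> 'a)"
    by (intro Ck_on_bounded_linear bounded_linear_fst)
  have snd: "Ck_on k UNIV (\<lambda>z :: 'a \<times> 'a. im_part (snd z))"
    by (intro Ck_on_bounded_linear bounded_linear_compose [OF bounded_linear_im_part] bounded_linear_snd)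
  show ?thesis
    unfolding slice_arsinh_def [abs_def]
    by (intro Ck_on_add Ck_on_scaleR Ck_on_const Ck_on_compose [OF Ck_on_arsinh] Ck_on_inner
        Ck_on_compose [OF Ck_on_imag_exp] fst snd)
qed

text \<open>\<open>slice_arsinh\<close> is smooth on the whole ambient space, so no local extensions
  off the image have to be built.\<close>

lemma diffeomorphic_range_slice_sinh:
  "diffeomorphic (range (slice_sinh :: 'a::slice_algebra \<Rightarrow> _)) (UNIV :: 'a set)"
  unfolding diffeomorphic_def
  by (intro exI [of _ slice_arsinh] exI [of _ slice_sinh] conjI smooth_map_on_UNIV_subset
      Ck_on_slice_sinh Ck_on_slice_arsinh)
    (auto simp: slice_arsinh_slice_sinh image_image)

section \<open>The differential and its conformality\<close>

definition slice_sinh_deriv :: "'a::hypercomplex \<Rightarrow> 'a \<Rightarrow> 'a \<times> 'a" where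
  "slice_sinh_deriv q w = ((cosh (hRe q) * hRe w) *\<^sub>R imag_exp (im_part q)
     + sinh (hRe q) *\<^sub>R imag_exp_deriv (im_part q) (im_part w), im_part w)"

lemma has_derivative_slice_sinh:
  "(slice_sinh has_derivative slice_sinh_deriv q) (at (q::'a::slice_algebra))"
proof -
  have im: "(im_part has_derivative im_part) (at q)"
    by (rule bounded_linear_imp_has_derivative [OF bounded_linear_im_part])
  have "(hRe has_derivative hRe) (at q)"
    unfolding hRe_eq_inner [abs_def]
    by (intro bounded_linear_imp_has_derivative bounded_linear_inner_left)
  moreover have "(sinh has_derivative (*) (cosh (hRe q))) (at (hRe q))"
    unfolding has_field_derivative_def [symmetric] by (auto intro!: derivative_eq_intros)
  ultimately have sinh: "((\<lambda>q. sinh (hRe q)) has_derivative (\<lambda>w. cosh (hRe q) * hRe w)) (at q)"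
    by (rule has_derivative_compose)
  have exp: "((\<lambda>q. imag_exp (im_part q)) has_derivative
      (\<lambda>w. imag_exp_deriv (im_part q) (im_part w))) (at q)"
    by (rule has_derivative_compose [OF im has_derivative_imag_exp])
  show ?thesis
    unfolding slice_sinh_def [abs_def] slice_sinh_deriv_def
    by (rule has_derivative_eq_rhs [OF has_derivative_Pair [OF has_derivative_scaleR [OF sinh exp] im]])
      (simp add: add.commute)
qed

lemma linear_slice_sinh_deriv: "linear (slice_sinh_deriv (q::'a::slice_algebra))"
  using has_derivative_slice_sinh by (rule has_derivative_linear)

lemma conformal_on_slice:
  fixes I :: "'a::slice_algebra"
  assumes "I \<in> imag_units"
  shows "conformal_on (slice I) (slice_sinh_deriv (x *\<^sub>R 1 + y *\<^sub>R I))" (is "conformal_on _ ?T")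
proof (rule conformal_onI)
  note I = assms assms [unfolded mem_imag_units_iff]
  show "(cosh x)\<^sup>2 \<noteq> 0"
    by simp
  fix w w' assume "w \<in> slice I" "w' \<in> slice I"
  then obtain a b a' b' where w: "w = a *\<^sub>R 1 + b *\<^sub>R I" "w' = a' *\<^sub>R 1 + b' *\<^sub>R I"
    unfolding slice_def by blast
  \<comment> \<open>\<open>?E\<close> is the exponential of \<open>y *\<^sub>R I\<close> and
    \<open>?F\<close> its derivative in \<open>y\<close>: the frame \<open>1\<close>,
    \<open>I\<close> rotated by the angle \<open>y\<close>, hence orthonormal.\<close>
  let ?E = "cos y *\<^sub>R 1 + sin y *\<^sub>R I" and ?F = "- sin y *\<^sub>R 1 + cos y *\<^sub>R I"
  have T: "?T (a *\<^sub>R 1 + b *\<^sub>R I) = ((cosh x * a) *\<^sub>R ?E + (sinh x * b) *\<^sub>R ?F, b *\<^sub>R I)" for a b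
    by (simp add: slice_sinh_deriv_def hRe_slice im_part_slice I imag_exp_unit imag_exp_deriv_unit
        del: scaleR_minus_left)
  have "?E \<bullet> ?E = 1" "?F \<bullet> ?F = 1" "?E \<bullet> ?F = 0" "?F \<bullet> ?E = 0"
    using I sin_cos_squared_add3 [of y]
    by (simp_all add: inner_add_left inner_add_right inner_diff_left inner_diff_right
        inner_one_one inner_commute)
  then have "?T w \<bullet> ?T w' = (cosh x)\<^sup>2 * (a * a') + ((sinh x)\<^sup>2 + 1) * (b * b')"
    unfolding w T inner_prod_def fst_conv snd_conv
    by (simp only: inner_add_left [of "_ *\<^sub>R ?E"] inner_add_right [of _ "_ *\<^sub>R ?E"]
        inner_scaleR_left inner_scaleR_right) (simp add: I power2_eq_square algebra_simps)
  \<comment> \<open>The summand 1 comes from the second component of the map; it turns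
    \<open>(sinh x)\<^sup>2\<close> into \<open>(cosh x)\<^sup>2\<close> and so equalises the two
    factors.\<close>
  also have "\<dots> = (cosh x)\<^sup>2 * (w \<bullet> w')"
    using I unfolding w cosh_square_eq
    by (simp add: inner_add_left inner_add_right inner_one_one inner_commute algebra_simps)
  finally show "?T w \<bullet> ?T w' = (cosh x)\<^sup>2 * (w \<bullet> w')" .
qed (rule subspace_slice linear_slice_sinh_deriv)+

lemma conformal_on_slice_orthogonal_comp:
  fixes I :: "'a::slice_algebra"
  assumes "I \<in> imag_units"
  shows "conformal_on (orthogonal_comp (slice I)) (slice_sinh_deriv (x *\<^sub>R 1 + y *\<^sub>R I))"
    (is "conformal_on _ ?T")
proof (rule conformal_onI)
  let ?c = "sinh x * sinc_sqrt ((y *\<^sub>R I) \<bullet> (y *\<^sub>R I))"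
  show "?c\<^sup>2 + 1 \<noteq> 0"
    using zero_le_power2 [of ?c] by linarith
  \<comment> \<open>Thus \<open>u\<close> in the complement is imaginary and orthogonal to
    \<open>y *\<^sub>R I\<close>, and the differential sends it to
    \<open>(?c *\<^sub>R u, u)\<close>. The second copy of \<open>u\<close> keeps the factor
    positive even where \<open>?c = 0\<close>.\<close>
  have "1 \<in> slice I" "I \<in> slice I"
    unfolding slice_def by (force intro: exI [of _ 0] exI [of _ 1])+
  then have T: "?T u = (?c *\<^sub>R u, u)" if "u \<in> orthogonal_comp (slice I)" for u
    using that assms
    by (simp add: slice_sinh_deriv_def hRe_slice im_part_slice im_part_eq [of u] hRe_eq_inner [of u]
        imag_exp_deriv_orthogonal orthogonal_comp_def orthogonal_def inner_commute)
  fix u u' assume "u \<in> orthogonal_comp (slice I)" "u' \<in> orthogonal_comp (slice I)"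
  then show "?T u \<bullet> ?T u' = (?c\<^sup>2 + 1) * (u \<bullet> u')"
    by (simp only: T) (simp add: inner_prod_def power2_eq_square algebra_simps)
qed (rule subspace_orthogonal_comp linear_slice_sinh_deriv)+

text \<open>The second component detects the imaginary part of \<open>w\<close>. What then remains
  of the first is \<open>cosh\<close> times the real part of \<open>w\<close> times a unit vector,
  and \<open>cosh\<close> never vanishes.\<close>

lemma inj_slice_sinh_deriv: "inj (slice_sinh_deriv (q::'a::slice_algebra))"
proof (rule linear_injective_0 [OF linear_slice_sinh_deriv, THEN iffD2], intro allI impI)
  fix w assume 0: "slice_sinh_deriv q w = 0"
  then have "im_part w = 0"
    by (simp add: slice_sinh_deriv_def zero_prod_def)
  with 0 have "hRe w = 0 \<or> imag_exp (im_part q) = 0"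
    by (simp add: slice_sinh_deriv_def imag_exp_deriv_orthogonal zero_prod_def)
  then have "hRe w = 0"
    using inner_imag_exp_self [OF inner_im_part_one [of q]] by auto
  with \<open>im_part w = 0\<close> show "w = 0"
    by (simp add: im_part_def)
qed

section \<open>Assembly for both algebras\<close>

lemma slice_isothermal_parameterization_slice_sinh:
  "slice_isothermal_parameterization (UNIV \<times> imag_space) UNIV (slice_sinh :: 'a::slice_algebra \<Rightarrow> _)"
proof -
  have "frechet_derivative slice_sinh (at q) = slice_sinh_deriv q" for q :: 'a
    by (rule frechet_derivative_at [OF has_derivative_slice_sinh, symmetric])
  moreover have "range (slice_sinh :: 'a \<Rightarrow> _) \<subseteq> UNIV \<times> imag_space"
    by (auto simp: slice_sinh_def imag_space_def hRe_eq_inner inner_im_part_one)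
  moreover have "inj (slice_sinh :: 'a \<Rightarrow> _)"
    by (rule inj_on_inverseI [where g = slice_arsinh]) (rule slice_arsinh_slice_sinh)
  ultimately show ?thesis
    unfolding slice_isothermal_parameterization_def slice_isothermal_def
    by (simp add: subspace_UNIV_Times_imag_space DIM_le_dim_UNIV_Times_imag_space
        slice_domain_UNIV Ck_on_slice_sinh conformal_on_slice conformal_on_slice_orthogonal_comp
        inj_slice_sinh_deriv del: Ck_on.simps One_nat_def)
qed

lemma sinh_slice_map_properties:
  "(\<exists>!f :: 'a::slice_algebra \<Rightarrow> 'a \<times> 'a. sinh_slice_map f) \<and>
   (\<forall>f :: 'a \<Rightarrow> 'a \<times> 'a. sinh_slice_map f \<longrightarrow>
      parameterized_hypercomplex_Riemann_manifold TYPE('a) (UNIV \<times> imag_space) (range f) \<and>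
      diffeomorphic (range f) (UNIV :: 'a set) \<and>
      slice_isothermal_parameterization (UNIV \<times> imag_space) UNIV f)"
  unfolding sinh_slice_map_iff parameterized_hypercomplex_Riemann_manifold_def
  using diffeomorphic_range_slice_sinh slice_isothermal_parameterization_slice_sinh by blast

theorem proposition4p3:
  shows "((\<exists>!f :: quat \<Rightarrow> quat \<times> quat. sinh_slice_map f) \<and>
    (\<forall>f :: quat \<Rightarrow> quat \<times> quat. sinh_slice_map f \<longrightarrow>
       parameterized_hypercomplex_Riemann_manifold TYPE(quat) (UNIV \<times> imag_space) (range f) \<and>
       diffeomorphic (range f) (UNIV :: quat set) \<and>
       slice_isothermal_parameterization (UNIV \<times> imag_space) UNIV f)) \<and>
   ((\<exists>!f :: octo \<Rightarrow> octo \<times> octo. sinh_slice_map f) \<and>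
    (\<forall>f :: octo \<Rightarrow> octo \<times> octo. sinh_slice_map f \<longrightarrow>
       parameterized_hypercomplex_Riemann_manifold TYPE(octo) (UNIV \<times> imag_space) (range f) \<and>
       diffeomorphic (range f) (UNIV :: octo set) \<and>
       slice_isothermal_parameterization (UNIV \<times> imag_space) UNIV f))"
  by (rule conjI; rule sinh_slice_map_properties)

end
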